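(* For $\mathbf{k}=(k_1,\dots,k_n)\in\mathbb{Z}_{\ge1}^n$ and $\sigma\in[0,\pi)$, \[ A\big(\mathbf{k};i\tan(\sigma/2)\big)=i^n\int_{0<\theta_1<\cdots<\theta_n<\theta_{n+1}=\sigma}\ \prod_{u=1}^n\frac{\big(\log\tan(\theta_{u+1}/2)-\log\tan(\theta_u/2)\big)^{k_u-1}}{(k_u-1)!}\,d\theta_u . \] In particular, \[ A(\mathbf{k};i)=i^n\int_{0<\theta_1<\cdots<\theta_n<\theta_{n+1}=\pi/2}\ \prod_{u=1}^n\frac{\big(\log\tan(\theta_{u+1}/2)-\log\tan(\theta_u/2)\big)^{k_u-1}}{(k_u-1)!}\,d\theta_u . \]
   Context: Multiple $A$-functions: for $\mathbf{k}\in\mathbb{Z}_{\ge1}^n$, $A(\mathbf{k};z)=2^n\sum_{0<m_1<\cdots<m_n,\ m_j\equiv j\bmod 2} z^{m_n}/(m_1^{k_1}\cdots m_n^{k_n})$ for $|z|<1$, continued holomorphically to $\mathbb{C}\setminus((-\infty,-1]\cup[1,\infty))$. *)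

theory Defs
  imports "HOL-Complex_Analysis.Complex_Analysis" "HOL-Number_Theory.Cong"
begin

text \<open>
  A multi-index $(k_1,\dots,k_n)$ is given by its length \<open>n\<close> and a function \<open>k\<close>,
  of which only the values on \<open>{1..n}\<close> are used.
\<close>

definition A_indices :: "nat \<Rightarrow> (nat \<Rightarrow> nat) set" where
  "A_indices n = {m \<in> {1..n} \<rightarrow>\<^sub>E UNIV.
     0 < m 1 \<and> (\<forall>j\<in>{1..<n}. m j < m (Suc j)) \<and> (\<forall>j\<in>{1..n}. [m j = j] (mod 2))}"

definition A_series :: "nat \<Rightarrow> (nat \<Rightarrow> nat) \<Rightarrow> complex \<Rightarrow> complex" where
  "A_series n k z =
     2 ^ n * (\<Sum>\<^sub>\<infinity>m\<in>A_indices n. z ^ m n / (\<Prod>j=1..n. of_nat (m j) ^ k j))"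

definition A_domain :: "complex set" where
  "A_domain = - complex_of_real ` ({..-1} \<union> {1..})"

text \<open>
  The continuation to the connected open set \<open>A_domain\<close> is unique, so that the description
  below determines the value at every point of \<open>A_domain\<close>. Outside it the value is unspecified.
\<close>

definition multiple_A :: "nat \<Rightarrow> (nat \<Rightarrow> nat) \<Rightarrow> complex \<Rightarrow> complex" where
  "multiple_A n k z =
     (THE w. \<exists>f. f holomorphic_on A_domain \<and> (\<forall>x\<in>ball 0 1. f x = A_series n k x) \<and> w = f z)"

text \<open>
  In both definitions below the update \<open>\<theta>(Suc n := \<sigma>)\<close> is the convention $\theta_{n+1} = \sigma$.
\<close>

definition angle_simplex :: "nat \<Rightarrow> real \<Rightarrow> (nat \<Rightarrow> real) set" where
  "angle_simplex n \<sigma> = {\<theta> \<in> {1..n} \<rightarrow>\<^sub>E UNIV.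
     0 < \<theta> 1 \<and> (\<forall>u\<in>{1..n}. (\<theta>(Suc n := \<sigma>)) u < (\<theta>(Suc n := \<sigma>)) (Suc u))}"

definition log_tan_integrand ::
  "nat \<Rightarrow> (nat \<Rightarrow> nat) \<Rightarrow> real \<Rightarrow> (nat \<Rightarrow> real) \<Rightarrow> real" where
  "log_tan_integrand n k \<sigma> \<theta> =
     (\<Prod>u=1..n. (ln (tan ((\<theta>(Suc n := \<sigma>)) (Suc u) / 2)) - ln (tan ((\<theta>(Suc n := \<sigma>)) u / 2)))
                 ^ (k u - 1) / fact (k u - 1))"

end

theory Submission imports Defs "HOL-Real_Asymp.Real_Asymp" begin

text \<open>
  On \<open>A_domain\<close>, which is star-shaped about \<open>0\<close>, the functions $A(\mathbf{k};\cdot)$ arise by iterated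
  primitives vanishing at \<open>0\<close>: $A(k_1,\dots,k_n,1;\cdot)$ is a primitive of
  $\frac{2}{1-z^2}A(k_1,\dots,k_n;\cdot)$, and raising the last entry by one means integrating against
  $dz/z$. Comparing Taylor coefficients identifies these functions with the defining series on the
  unit disc. Along $z=i\tan(\sigma/2)$ the two differential forms become $i\,d\sigma$ and
  $d\log\tan(\sigma/2)$; the repeated integrations against the latter collapse to a single kernel
  $(\log\tan(\sigma/2)-\log\tan(\theta/2))^{k-1}/(k-1)!$. All integrands are nonnegative, so
  Tonelli's theorem turns the iterated integral into the integral over the simplex.
\<close>

subsection \<open>The holomorphic continuation\<close>

lemma A_domain_eq: "A_domain = {z. Im z \<noteq> 0 \<or> \<bar>Re z\<bar> < 1}"
  unfolding A_domain_def
  by (auto simp: image_iff complex_eq_iff)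

lemma open_A_domain: "open A_domain"
proof -
  have eq: "A_domain = {z. Im z \<noteq> 0} \<union> {z. \<bar>Re z\<bar> < 1}"
    by (auto simp: A_domain_eq)
  show ?thesis
    unfolding eq by (intro open_Un open_Collect_neq open_Collect_less continuous_intros)
qed

lemma zero_in_A_domain: "0 \<in> A_domain"
  by (simp add: A_domain_eq)

text \<open>Serves twice: it provides primitives of holomorphic functions, and connectedness for the
  identity theorem.\<close>

lemma starlike_A_domain: "starlike A_domain"
  unfolding starlike_def
proof (intro bexI ballI subsetI)
  fix z w assume z: "z \<in> A_domain" and "w \<in> closed_segment 0 z"
  then obtain u where u: "0 \<le> u" "u \<le> 1" "w = u *\<^sub>R z"
    by (auto simp: closed_segment_def)
  have "\<bar>Re w\<bar> < 1" if "\<bar>Re z\<bar> < 1"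
    using mult_left_le_one_le[of "\<bar>Re z\<bar>" u] u that by (simp add: abs_mult)
  with z u show "w \<in> A_domain"
    by (cases "u = 0") (auto simp: A_domain_eq)
qed (rule zero_in_A_domain)

lemma ball_subset_A_domain: "ball 0 1 \<subseteq> A_domain"
proof
  fix z :: complex assume "z \<in> ball 0 1"
  with abs_Re_le_cmod[of z] show "z \<in> A_domain" by (simp add: A_domain_eq)
qed

lemma A_domain_imp_square_neq_1: "z \<in> A_domain \<Longrightarrow> 1 - z\<^sup>2 \<noteq> 0"
  by (auto simp: A_domain_eq power2_eq_1_iff)

text \<open>By the identity theorem on the connected set \<open>A_domain\<close> any two
  continuations agree, so exhibiting one of them evaluates the definite description.\<close>

lemma multiple_A_eqI:
  assumes f: "f holomorphic_on A_domain" and eq: "\<And>x. x \<in> ball 0 1 \<Longrightarrow> f x = A_series n k x"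
    and z: "z \<in> A_domain"
  shows "multiple_A n k z = f z"
  unfolding multiple_A_def
proof (rule the_equality)
  show "\<exists>g. g holomorphic_on A_domain \<and> (\<forall>x\<in>ball 0 1. g x = A_series n k x) \<and> f z = g z"
    using f eq by blast
next
  fix w assume "\<exists>g. g holomorphic_on A_domain \<and> (\<forall>x\<in>ball 0 1. g x = A_series n k x) \<and> w = g z"
  then obtain g where g: "g holomorphic_on A_domain" "\<And>x. x \<in> ball 0 1 \<Longrightarrow> g x = A_series n k x" "w = g z"
    by blast
  have "connected A_domain"
    by (simp add: starlike_A_domain starlike_imp_connected)
  then have "g z = f z"
    by (intro analytic_continuation_open[OF open_ball open_A_domain _ _ ball_subset_A_domain g(1) f _ z])
       (auto simp: g(2) eq)
  with g show "w = f z" by simp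
qed

section \<open>Iterated primitives normalised at the origin\<close>

definition origin_primitive :: "(complex \<Rightarrow> complex) \<Rightarrow> complex \<Rightarrow> complex" where
  "origin_primitive g =
     (SOME G. G 0 = 0 \<and> (\<forall>z\<in>A_domain. (G has_field_derivative g z) (at z)))"

lemma
  assumes g: "g holomorphic_on A_domain"
  shows origin_primitive_0: "origin_primitive g 0 = 0"
    and has_field_derivative_origin_primitive:
      "\<And>z. z \<in> A_domain \<Longrightarrow> (origin_primitive g has_field_derivative g z) (at z)"
proof -
  have "\<exists>G. \<forall>z\<in>A_domain. (G has_field_derivative g z) (at z)"
    by (rule holomorphic_starlike_primitive[where k = "{}"])
       (use g open_A_domain starlike_A_domain in
         \<open>auto simp: holomorphic_on_imp_continuous_on holomorphic_on_open field_differentiable_def\<close>)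
  then obtain G where G: "\<And>z. z \<in> A_domain \<Longrightarrow> (G has_field_derivative g z) (at z)"
    by blast
  have "\<exists>G. G 0 = 0 \<and> (\<forall>z\<in>A_domain. (G has_field_derivative g z) (at z))"
    by (rule exI[of _ "\<lambda>z. G z - G 0"]) (auto intro!: derivative_eq_intros G)
  from someI_ex[OF this, folded origin_primitive_def]
  show "origin_primitive g 0 = 0"
    "\<And>z. z \<in> A_domain \<Longrightarrow> (origin_primitive g has_field_derivative g z) (at z)"
    by auto
qed

lemma holomorphic_on_origin_primitive:
  assumes "g holomorphic_on A_domain"
  shows "origin_primitive g holomorphic_on A_domain"
  using has_field_derivative_origin_primitive[OF assms] open_A_domain
  by (auto simp: holomorphic_on_open)

text \<open>
  With the index shifted by one, \<open>A_tower f j\<close> is \<open>A(k\<^sub>1,\<dots>,k\<^sub>n,j+1; \<cdot>)\<close> when \<open>f\<close> is \<open>A(k\<^sub>1,\<dots>,k\<^sub>n; \<cdot>)\<close>.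
\<close>
fun A_tower :: "(complex \<Rightarrow> complex) \<Rightarrow> nat \<Rightarrow> complex \<Rightarrow> complex" where
  "A_tower f 0 = origin_primitive (\<lambda>z. 2 * f z / (1 - z\<^sup>2))"
| "A_tower f (Suc j) =
     origin_primitive (\<lambda>z. if z = 0 then deriv (A_tower f j) 0 else A_tower f j z / z)"

lemma A_tower_integrand_holomorphic:
  assumes f: "f holomorphic_on A_domain"
  shows "(\<lambda>z. 2 * f z / (1 - z\<^sup>2)) holomorphic_on A_domain"
  using A_domain_imp_square_neq_1 by (intro holomorphic_intros f) auto

text \<open>The singularity of f(z)/z at 0 is removable because f vanishes there; the value to fill
  in is f'(0).\<close>

lemma quotient_by_id_holomorphic:
  assumes f: "f holomorphic_on A_domain" and "f 0 = 0"
  shows "(\<lambda>z. if z = 0 then deriv f 0 else f z / z) holomorphic_on A_domain"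
  using pole_lemma_open[OF f open_A_domain, of 0] unfolding assms(2) diff_zero .

text \<open>Both claims share one induction: vanishing at 0 is what makes the next integrand, a
  quotient by z, holomorphic.\<close>

lemma
  assumes f: "f holomorphic_on A_domain"
  shows holomorphic_on_A_tower: "A_tower f j holomorphic_on A_domain"
    and A_tower_at_0: "A_tower f j 0 = 0"
proof (induction j)
  case 0
  {
    case 1 show ?case
      using A_tower_integrand_holomorphic[OF f] by (simp add: holomorphic_on_origin_primitive)
    case 2 show ?case
      using A_tower_integrand_holomorphic[OF f] by (simp add: origin_primitive_0)
  }
next
  case (Suc j)
  note h = quotient_by_id_holomorphic[OF Suc.IH]
  {
    case 1 show ?case using h by (simp add: holomorphic_on_origin_primitive)
    case 2 show ?case using h by (simp add: origin_primitive_0)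
  }
qed

lemma
  assumes f: "f holomorphic_on A_domain" and z: "z \<in> A_domain"
  shows A_tower_0_deriv: "(A_tower f 0 has_field_derivative 2 * f z / (1 - z\<^sup>2)) (at z)"
    and A_tower_Suc_deriv: "z \<noteq> 0 \<Longrightarrow> (A_tower f (Suc j) has_field_derivative A_tower f j z / z) (at z)"
proof -
  show "(A_tower f 0 has_field_derivative 2 * f z / (1 - z\<^sup>2)) (at z)"
    using has_field_derivative_origin_primitive[OF A_tower_integrand_holomorphic[OF f] z] by simp
  show "(A_tower f (Suc j) has_field_derivative A_tower f j z / z) (at z)" if "z \<noteq> 0"
    using has_field_derivative_origin_primitive[OF
        quotient_by_id_holomorphic[OF holomorphic_on_A_tower A_tower_at_0, OF f f] z] that
    by simp
qed

text \<open>The subtraction of 1 is due to level 0 of \<open>A_tower\<close>, which already accounts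
  for an entry equal to 1. The empty index gets the constant 1.\<close>

fun A_ext :: "(nat \<Rightarrow> nat) \<Rightarrow> nat \<Rightarrow> complex \<Rightarrow> complex" where
  "A_ext k 0 = (\<lambda>_. 1)"
| "A_ext k (Suc n) = A_tower (A_ext k n) (k (Suc n) - 1)"

lemma holomorphic_on_A_ext: "A_ext k n holomorphic_on A_domain"
  by (induction n) (auto intro: holomorphic_on_A_tower)

section \<open>Taylor coefficients of the iterated primitives\<close>

lemma eventually_nhds_0_A_domain: "eventually (\<lambda>z. z \<in> A_domain) (nhds 0)"
  using open_A_domain zero_in_A_domain by (rule eventually_nhds_in_open)

lemma fps_nth_mult_1_minus_X2:
  "fps_nth ((1 - fps_X\<^sup>2) * F) m = fps_nth (F :: complex fps) m - (if m < 2 then 0 else fps_nth F (m - 2))"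
  by (simp add: left_diff_distrib fps_X_power_mult_nth)

text \<open>The equation (1 - z^2) H' = 2 f is a two-step recurrence for the coefficients of H.
  Unrolling it collects the coefficients of f at all smaller positions of opposite parity.\<close>

lemma A_tower_0_fps:
  assumes f: "f holomorphic_on A_domain" and F: "f has_fps_expansion F"
    and H: "A_tower f 0 has_fps_expansion H"
  shows "of_nat m * fps_nth H m = 2 * (\<Sum>l | l < m \<and> odd (m - l). fps_nth F l)"
proof -
  have "(\<lambda>z. (1 - z\<^sup>2) * deriv (A_tower f 0) z) has_fps_expansion (1 - fps_X\<^sup>2) * fps_deriv H"
    by (intro fps_expansion_intros has_fps_expansion_deriv H)
  moreover have "eventually (\<lambda>z. (1 - z\<^sup>2) * deriv (A_tower f 0) z = 2 * f z) (nhds 0)"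
    using eventually_nhds_0_A_domain
  proof eventually_elim
    case (elim z)
    with DERIV_imp_deriv[OF A_tower_0_deriv[OF f elim]] A_domain_imp_square_neq_1[OF elim]
    show ?case by simp
  qed
  ultimately have "(\<lambda>z. 2 * f z) has_fps_expansion (1 - fps_X\<^sup>2) * fps_deriv H"
    by (simp cong: has_fps_expansion_cong)
  moreover have "(\<lambda>z. 2 * f z) has_fps_expansion fps_const 2 * F"
    by (intro fps_expansion_intros F)
  ultimately have eq: "(1 - fps_X\<^sup>2) * fps_deriv H = fps_const 2 * F"
    by (rule fps_expansion_unique_complex)
  \<comment> \<open>For m = 0 and m = 1 the factor \<open>of_nat (m - 1)\<close> is 0, so one
    formula covers the initial cases as well.\<close>
  have rec: "of_nat (Suc m) * fps_nth H (Suc m) = 2 * fps_nth F m + of_nat (m - 1) * fps_nth H (m - 1)"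
    for m
  proof -
    from eq have "fps_nth ((1 - fps_X\<^sup>2) * fps_deriv H) m = 2 * fps_nth F m"
      by simp
    then show ?thesis
      unfolding fps_nth_mult_1_minus_X2
      by (cases "m < 2") (auto simp: less_2_cases_iff algebra_simps numeral_2_eq_2 Suc_diff_Suc)
  qed
  show ?thesis
  proof (induction m rule: less_induct)
    case (less m)
    show ?case
    proof (cases m)
      case (Suc m')
      show ?thesis
      proof (cases "m' = 0")
        case True
        have "{l. l < m \<and> odd (m - l)} = {0}" using Suc True by auto
        then show ?thesis using rec[of 0] Suc True by simp
      next
        case False
        \<comment> \<open>The largest admissible position m - 1 is split off; the rest is the index
          set belonging to m - 2.\<close>
        have "{l. l < m \<and> odd (m - l)} = insert m' {l. l < m' - 1 \<and> odd (m' - 1 - l)}"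
          using Suc False by (auto simp: less_Suc_eq) presburger+
        then show ?thesis
          using rec[of m'] less[of "m' - 1"] Suc by (simp add: algebra_simps)
      qed
    qed simp
  qed
qed

text \<open>Integrating against dz/z inverts the Euler operator z d/dz, which multiplies the m-th
  coefficient by m.\<close>

lemma A_tower_Suc_fps:
  assumes f: "f holomorphic_on A_domain" 
    and H: "A_tower f j has_fps_expansion H"
    and H': "A_tower f (Suc j) has_fps_expansion H'"
  shows "of_nat m * fps_nth H' m = fps_nth H m"
proof -
  have "(\<lambda>z. z * deriv (A_tower f (Suc j)) z) has_fps_expansion fps_X * fps_deriv H'"
    by (intro fps_expansion_intros has_fps_expansion_deriv H')
  moreover have "eventually (\<lambda>z. z * deriv (A_tower f (Suc j)) z = A_tower f j z) (nhds 0)"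
    using eventually_nhds_0_A_domain
  proof eventually_elim
    case (elim z)
    then show ?case
      using DERIV_imp_deriv[OF A_tower_Suc_deriv[OF f elim, of j]] A_tower_at_0[OF f, of j]
      by (cases "z = 0") auto
  qed
  ultimately have "A_tower f j has_fps_expansion fps_X * fps_deriv H'"
    by (simp del: A_tower.simps cong: has_fps_expansion_cong)
  from fps_expansion_unique_complex[OF this H] have "fps_nth (fps_X * fps_deriv H') m = fps_nth H m"
    by simp
  then show ?thesis by (cases m) (auto simp: algebra_simps)
qed

text \<open>One factor 1/m comes from the bottom primitive and one from each of the j further
  integrations. The recurrences carry a factor m and so say nothing about the constant term, which
  is read off from the value at 0.\<close>

lemma A_tower_fps:
  assumes f: "f holomorphic_on A_domain" and F: "f has_fps_expansion F"
    and H: "A_tower f j has_fps_expansion H"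
  shows "fps_nth H m = 2 * (\<Sum>l | l < m \<and> odd (m - l). fps_nth F l) / of_nat m ^ Suc j"
proof (cases "m = 0")
  case True
  have "fps_nth H 0 = 0"
    using H A_tower_at_0[OF f] by (metis has_fps_expansion_imp_0_eq_fps_nth_0)
  with True show ?thesis by simp
next
  case False
  from H have "of_nat m ^ Suc j * fps_nth H m = 2 * (\<Sum>l | l < m \<and> odd (m - l). fps_nth F l)"
  proof (induction j arbitrary: H)
    case 0
    from A_tower_0_fps[OF f F this] show ?case by simp
  next
    case (Suc j)
    have G: "A_tower f j has_fps_expansion fps_expansion (A_tower f j) 0"
      using open_A_domain zero_in_A_domain holomorphic_on_A_tower[OF f] by blast
    have "of_nat m ^ Suc (Suc j) * fps_nth H m = of_nat m ^ Suc j * (of_nat m * fps_nth H m)"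
      by (simp only: power_Suc2[of _ "Suc j"] mult.assoc)
    with A_tower_Suc_fps[OF f G Suc.prems, of m] Suc.IH[OF G] show ?case
      by presburger
  qed
  with False show ?thesis by (simp add: field_simps)
qed

text \<open>The part of the multiple sum with m_n = m fixed, as a recursion on the last entry. Odd
  gaps starting from m_0 = 0 encode the condition that m_j is congruent to j mod 2.\<close>

fun A_coeff :: "(nat \<Rightarrow> nat) \<Rightarrow> nat \<Rightarrow> nat \<Rightarrow> real" where
  "A_coeff k 0 m = (if m = 0 then 1 else 0)"
| "A_coeff k (Suc n) m = 2 * (\<Sum>l | l < m \<and> odd (m - l). A_coeff k n l) / real m ^ k (Suc n)"

lemma A_ext_has_fps_expansion:
  assumes "\<And>u. u \<in> {1..n} \<Longrightarrow> k u \<ge> 1"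
  shows "A_ext k n has_fps_expansion Abs_fps (\<lambda>m. complex_of_real (A_coeff k n m))"
  using assms
proof (induction n)
  case 0
  have "Abs_fps (\<lambda>m. complex_of_real (A_coeff k 0 m)) = 1"
    by (simp add: fps_eq_iff)
  then show ?case by (simp add: has_fps_expansion_1)
next
  case (Suc n)
  let ?H = "fps_expansion (A_ext k (Suc n)) 0"
  have H: "A_ext k (Suc n) has_fps_expansion ?H"
    using open_A_domain zero_in_A_domain holomorphic_on_A_ext by blast
  have K: "Suc (k (Suc n) - 1) = k (Suc n)"
    using Suc.prems[of "Suc n"] by simp
  have "fps_nth ?H m = complex_of_real (A_coeff k (Suc n) m)" for m
    using A_tower_fps[OF holomorphic_on_A_ext Suc.IH H[unfolded A_ext.simps]] Suc.prems
    unfolding K by simp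
  then have "?H = Abs_fps (\<lambda>m. complex_of_real (A_coeff k (Suc n) m))"
    by (simp add: fps_eq_iff)
  with H show ?case by simp
qed

text \<open>Holomorphy on the unit disc already gives convergence of the Taylor series on all of it,
  without estimating coefficients.\<close>

lemma A_ext_sums:
  assumes "\<And>u. u \<in> {1..n} \<Longrightarrow> k u \<ge> 1" and z: "norm z < 1"
  shows "(\<lambda>m. complex_of_real (A_coeff k n m) * z ^ m) sums A_ext k n z"
proof -
  have "A_ext k n holomorphic_on eball 0 (ereal 1)"
    using holomorphic_on_subset[OF holomorphic_on_A_ext ball_subset_A_domain] by simp
  from has_fps_expansion_imp_sums_complex[OF A_ext_has_fps_expansion[of n k] this, of z] z assms(1)
  show ?thesis by simp
qed

subsection \<open>Comparison with the defining series\<close>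

text \<open>
  Unlike \<open>A_indices\<close>, the following set follows the convention $m_0 = 0$, which makes it a
  singleton for \<open>n = 0\<close> and allows induction from there; likewise \<open>last_index\<close> is $m_n$.
\<close>
definition A_indices' :: "nat \<Rightarrow> (nat \<Rightarrow> nat) set" where
  "A_indices' n = {m \<in> {1..n} \<rightarrow>\<^sub>E UNIV.
     \<forall>j\<in>{1..n}. (m(0 := 0)) (j - 1) < m j \<and> [m j = j] (mod 2)}"

definition last_index :: "nat \<Rightarrow> (nat \<Rightarrow> nat) \<Rightarrow> nat" where
  "last_index n m = (m(0 := 0)) n"

text \<open>The indices contributing to the coefficient of z^l: the multiple sum is grouped along
  these fibres.\<close>

definition A_level :: "nat \<Rightarrow> nat \<Rightarrow> (nat \<Rightarrow> nat) set" where
  "A_level n l = {m \<in> A_indices' n. last_index n m = l}"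

lemma A_indices'_eq:
  assumes "n \<ge> 1"
  shows "A_indices' n = A_indices n"
proof -
  have "(\<forall>j\<in>{1..n}. (m(0 := 0)) (j - 1) < m j) \<longleftrightarrow> 0 < m 1 \<and> (\<forall>j\<in>{1..<n}. m j < m (Suc j))"
    (is "?L \<longleftrightarrow> ?R") for m :: "nat \<Rightarrow> nat"
  proof
    assume L: ?L
    have "m j < m (Suc j)" if "j \<in> {1..<n}" for j
      using bspec[OF L, of "Suc j"] that by simp
    with bspec[OF L, of 1] assms show ?R by simp
  next
    assume R: ?R
    show ?L
    proof
      fix j assume j: "j \<in> {1..n}"
      show "(m(0 := 0)) (j - 1) < m j"
      proof (cases "j = 1")
        case False
        with j obtain i where "j = Suc i" "i \<in> {1..<n}" by (cases j) auto
        with R show ?thesis by simp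
      qed (use R in simp)
    qed
  qed
  then show ?thesis
    unfolding A_indices'_def A_indices_def by blast
qed

text \<open>Turns the congruence imposed on a new last entry into oddness of its gap to the previous
  one.\<close>

lemma last_index_parity:
  assumes "m \<in> A_indices' n"
  shows "even (last_index n m) = even n"
  using assms by (cases "n = 0") (auto simp: A_indices'_def last_index_def cong_def even_iff_mod_2_eq_zero)

lemma A_level_0: "A_level 0 l = (if l = 0 then {\<lambda>_. undefined} else {})"
  by (auto simp: A_level_def A_indices'_def last_index_def)

lemma A_level_Suc:
  "A_level (Suc n) l = (\<lambda>m. m(Suc n := l)) ` (\<Union>l'\<in>{l'. l' < l \<and> odd (l - l')}. A_level n l')"
  (is "_ = ?f ` ?B")
proof (intro equalityI subsetI)
  fix m assume m: "m \<in> A_level (Suc n) l"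
  \<comment> \<open>Resetting the deleted entry to \<open>undefined\<close> restores extensionality
    on {1..n}.\<close>
  define m' where "m' = m(Suc n := undefined)"
  from m have ml: "m (Suc n) = l" by (simp add: A_level_def last_index_def)
  have m': "m' \<in> A_indices' n"
    unfolding A_indices'_def
  proof (intro CollectI conjI ballI)
    show "m' \<in> {1..n} \<rightarrow>\<^sub>E UNIV"
      using m by (auto simp: A_level_def A_indices'_def m'_def PiE_def extensional_def)
    fix j assume j: "j \<in> {1..n}"
    with m have "(m(0 := 0)) (j - 1) < m j \<and> [m j = j] (mod 2)"
      by (simp add: A_level_def A_indices'_def)
    with j show "(m'(0 := 0)) (j - 1) < m' j" "[m' j = j] (mod 2)"
      by (auto simp: m'_def)
  qed
  have *: "(m(0 := 0)) n < l" "[l = Suc n] (mod 2)"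
    using m unfolding A_level_def A_indices'_def ml[symmetric] by (auto dest: bspec[of _ _ "Suc n"])
  have last: "last_index n m' = (m(0 := 0)) n"
    by (simp add: m'_def last_index_def)
  with last_index_parity[OF m'] * have "even (last_index n m') = even n" "odd l = even n"
    by (auto simp: cong_def even_iff_mod_2_eq_zero mod_Suc)
  with * last m' have "m' \<in> ?B"
    by (auto simp: A_level_def)
  moreover have "m = ?f m'" using ml by (auto simp: m'_def)
  ultimately show "m \<in> ?f ` ?B" by blast
next
  fix m assume "m \<in> ?f ` ?B"
  then obtain m' where m': "m' \<in> A_indices' n" "last_index n m' < l" "odd (l - last_index n m')"
      "m = ?f m'"
    by (auto simp: A_level_def)
  have "[l = Suc n] (mod 2)"
    using last_index_parity[OF m'(1)] m'(2,3) by (auto simp: cong_def mod2_eq_if)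
  have "m \<in> A_indices' (Suc n)"
    unfolding A_indices'_def
  proof (intro CollectI conjI ballI)
    show "m \<in> {1..Suc n} \<rightarrow>\<^sub>E UNIV"
      using m' by (auto simp: A_indices'_def PiE_def extensional_def)
    fix j assume j: "j \<in> {1..Suc n}"
    show "(m(0 := 0)) (j - 1) < m j" "[m j = j] (mod 2)"
    proof (atomize (full), cases "j = Suc n")
      case True
      with \<open>[l = Suc n] (mod 2)\<close> m'(2,4) show "(m(0 := 0)) (j - 1) < m j \<and> [m j = j] (mod 2)"
        by (simp add: last_index_def split: if_splits)
    next
      case False
      with j have "j \<in> {1..n}" by simp
      with m'(1) have "(m'(0 := 0)) (j - 1) < m' j \<and> [m' j = j] (mod 2)"
        by (simp add: A_indices'_def)
      with \<open>j \<in> {1..n}\<close> show "(m(0 := 0)) (j - 1) < m j \<and> [m j = j] (mod 2)"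
        by (auto simp: m'(4))
    qed
  qed
  then show "m \<in> A_level (Suc n) l"
    by (simp add: A_level_def last_index_def m'(4))
qed

lemma finite_A_level: "finite (A_level n l)"
  by (induction n arbitrary: l) (simp_all add: A_level_0 A_level_Suc)

text \<open>Appending a last entry l multiplies each term by 2 / l^k with k the new exponent, which
  is the recursion of \<open>A_coeff\<close>.\<close>

lemma sum_A_level:
  "(\<Sum>m\<in>A_level n l. 2 ^ n / (\<Prod>j=1..n. real (m j) ^ k j)) = A_coeff k n l"
proof (induction n arbitrary: l)
  case 0
  show ?case by (simp add: A_level_0)
next
  case (Suc n)
  let ?I = "{l'. l' < l \<and> odd (l - l')}"
  \<comment> \<open>The shorter chains are all \<open>undefined\<close> at position n + 1, so
    overwriting it loses no information.\<close>
  have "inj_on (\<lambda>m. m(Suc n := l)) (\<Union>l'\<in>?I. A_level n l')"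
  proof (rule inj_onI)
    fix m m' assume "m \<in> (\<Union>l'\<in>?I. A_level n l')" "m' \<in> (\<Union>l'\<in>?I. A_level n l')"
      and eq: "m(Suc n := l) = m'(Suc n := l)"
    then have "m (Suc n) = undefined" "m' (Suc n) = undefined"
      by (auto simp: A_level_def A_indices'_def PiE_def extensional_def)
    with eq show "m = m'"
      by (metis fun_upd_triv fun_upd_upd)
  qed
  then have "(\<Sum>m\<in>A_level (Suc n) l. 2 ^ Suc n / (\<Prod>j=1..Suc n. real (m j) ^ k j)) =
      (\<Sum>m\<in>(\<Union>l'\<in>?I. A_level n l'). 2 ^ Suc n / (\<Prod>j=1..Suc n. real ((m(Suc n := l)) j) ^ k j))"
    unfolding A_level_Suc by (simp only: sum.reindex o_def)
  also have "\<dots> = (\<Sum>m\<in>(\<Union>l'\<in>?I. A_level n l').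
      2 / real l ^ k (Suc n) * (2 ^ n / (\<Prod>j=1..n. real (m j) ^ k j)))"
    by (intro sum.cong) auto
  also have "\<dots> = (\<Sum>l'\<in>?I. \<Sum>m\<in>A_level n l'.
      2 / real l ^ k (Suc n) * (2 ^ n / (\<Prod>j=1..n. real (m j) ^ k j)))"
    by (intro sum.UNION_disjoint) (auto simp: finite_A_level, auto simp: A_level_def)
  also have "\<dots> = A_coeff k (Suc n) l"
    unfolding sum_distrib_left[symmetric] Suc.IH by simp
  finally show ?case .
qed

lemma A_coeff_nonneg: "A_coeff k n l \<ge> 0"
  unfolding sum_A_level[symmetric] by (intro sum_nonneg divide_nonneg_nonneg prod_nonneg) auto

text \<open>The coefficients are nonnegative, so convergence of the power series at |z| makes the
  family over all pairs (l, m) absolutely summable. It may then be summed by levels, giving the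
  power series, or over all indices, giving the defining series.\<close>

lemma A_series_eq_A_ext:
  assumes n: "n \<ge> 1" and k: "\<And>u. u \<in> {1..n} \<Longrightarrow> k u \<ge> 1" and z: "norm z < 1"
  shows "A_series n k z = A_ext k n z"
proof -
  define t :: "nat \<times> (nat \<Rightarrow> nat) \<Rightarrow> complex" where
    "t = (\<lambda>(l, m). of_real (2 ^ n / (\<Prod>j=1..n. real (m j) ^ k j)) * z ^ l)"
  have fin: "((\<lambda>m. t (l, m)) has_sum (of_real (A_coeff k n l) * z ^ l)) (A_level n l)" for l
    by (rule has_sum_finiteI)
       (simp_all add: finite_A_level t_def sum_A_level[symmetric] sum_distrib_right)
  have "norm (t (l, m)) = 2 ^ n / (\<Prod>j=1..n. real (m j) ^ k j) * norm z ^ l" for l m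
    unfolding t_def
    by (simp add: norm_mult norm_power norm_divide prod_norm[symmetric])
  then have fin': "((\<lambda>m. norm (t (l, m))) has_sum (A_coeff k n l * norm z ^ l)) (A_level n l)" for l
    by (intro has_sum_finiteI)
       (simp_all add: finite_A_level sum_A_level[symmetric] sum_distrib_right)
  \<comment> \<open>At the real point |z| the Taylor series is its own series of absolute
    values.\<close>
  have "summable (\<lambda>l. complex_of_real (A_coeff k n l * norm z ^ l))"
    using A_ext_sums[of n k "of_real (norm z)", OF k] z by (simp add: sums_iff)
  then have summ: "summable (\<lambda>l. A_coeff k n l * norm z ^ l)"
    by (simp only: summable_of_real_iff)
  then have "(\<lambda>l. A_coeff k n l * norm z ^ l) summable_on UNIV"
    by (intro norm_summable_imp_summable_on) (simp add: abs_mult A_coeff_nonneg)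
  then have "(\<lambda>x. norm (t x)) summable_on Sigma UNIV (A_level n)"
    by (rule summable_on_SigmaI[OF fin']) simp
  then have 1: "t summable_on Sigma UNIV (A_level n)"
    by (rule abs_summable_summable)
  have 2: "((\<lambda>l. of_real (A_coeff k n l) * z ^ l) has_sum A_ext k n z) UNIV"
    using summ by (intro norm_summable_imp_has_sum A_ext_sums k z)
       (simp_all add: norm_mult norm_power A_coeff_nonneg)
  have "(t has_sum A_ext k n z) (Sigma UNIV (A_level n))"
    by (rule has_sum_SigmaI[OF fin 2 1])
  also have "?this \<longleftrightarrow> ((\<lambda>m. 2 ^ n * (z ^ m n / (\<Prod>j=1..n. of_nat (m j) ^ k j))) has_sum A_ext k n z) (A_indices n)"
    by (rule has_sum_reindex_bij_witness[of _ "\<lambda>m. (last_index n m, m)" snd])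
       (use n in \<open>auto simp: A_indices'_eq[symmetric] A_level_def t_def last_index_def\<close>)
  finally have s: "(\<Sum>\<^sub>\<infinity>m\<in>A_indices n. 2 ^ n * (z ^ m n / (\<Prod>j=1..n. of_nat (m j) ^ k j))) = A_ext k n z"
    by (rule infsumI)
  show ?thesis
    unfolding A_series_def s[symmetric] by (rule infsum_cmult_right'[symmetric])
qed

lemma multiple_A_eq_A_ext:
  assumes "n \<ge> 1" and "\<And>u. u \<in> {1..n} \<Longrightarrow> k u \<ge> 1" and "z \<in> A_domain"
  shows "multiple_A n k z = A_ext k n z"
proof (rule multiple_A_eqI[OF holomorphic_on_A_ext _ assms(3)])
  show "A_ext k n x = A_series n k x" if "x \<in> ball 0 1" for x
    using A_series_eq_A_ext[of n k x, OF assms(1,2)] that by simp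
qed

subsection \<open>Restriction to the imaginary axis\<close>

lemma imaginary_in_A_domain: "\<i> * complex_of_real t \<in> A_domain"
  by (simp add: A_domain_eq)

lemma cos_half_pos: "\<bar>s\<bar> < pi \<Longrightarrow> cos (s / 2) > 0"
  by (intro cos_gt_zero_pi) auto

lemma DERIV_tan_half:
  assumes "\<bar>s\<bar> < pi"
  shows "((\<lambda>s. tan (s / 2)) has_real_derivative (1 + (tan (s / 2))\<^sup>2) / 2) (at s)"
  using cos_half_pos[OF assms]
  by (auto intro!: derivative_eq_intros simp: tan_sec power_inverse)

text \<open>The half-angle formula sin s = 2t / (1 + t^2) for t = tan(s/2), cleared of
  denominators.\<close>

lemma sin_eq_tan_half:
  assumes "\<bar>s\<bar> < pi"
  shows "sin s * (1 + (tan (s / 2))\<^sup>2) = 2 * tan (s / 2)"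
proof -
  have "sin s = 2 * sin (s / 2) * cos (s / 2)"
    using sin_double[of "s / 2"] by simp
  then show ?thesis
    using cos_half_pos[OF assms] by (simp add: tan_sec tan_def divide_simps power2_eq_square)
qed

lemma DERIV_ln_tan_half:
  assumes "0 < s" "s < pi"
  shows "((\<lambda>s. ln (tan (s / 2))) has_real_derivative 1 / sin s) (at s)"
proof -
  have t: "tan (s / 2) > 0" using assms by (intro tan_gt_zero) auto
  have "sin s > 0" using assms by (intro sin_gt_zero)
  then have "(1 + (tan (s / 2))\<^sup>2) / 2 / tan (s / 2) = 1 / sin s"
    using sin_eq_tan_half[of s] assms t by (simp add: field_simps)
  moreover have "((\<lambda>s. ln (tan (s / 2))) has_real_derivative (1 + (tan (s / 2))\<^sup>2) / 2 / tan (s / 2)) (at s)"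
    by (rule DERIV_chain'[OF DERIV_tan_half, THEN DERIV_cong])
       (use assms t in \<open>auto intro!: derivative_eq_intros simp: field_simps\<close>)
  ultimately show ?thesis by simp
qed

definition on_path :: "(complex \<Rightarrow> complex) \<Rightarrow> real \<Rightarrow> complex" where
  "on_path f s = f (\<i> * complex_of_real (tan (s / 2)))"

lemma on_path_deriv:
  assumes "(f has_field_derivative f') (at (\<i> * complex_of_real (tan (s / 2))))" and "\<bar>s\<bar> < pi"
  shows "(on_path f has_vector_derivative \<i> * of_real ((1 + (tan (s / 2))\<^sup>2) / 2) * f') (at s)"
proof -
  have "((\<lambda>s. \<i> * complex_of_real (tan (s / 2))) has_vector_derivative
      \<i> * of_real ((1 + (tan (s / 2))\<^sup>2) / 2)) (at s)"
    by (intro has_vector_derivative_mult_right has_vector_derivative_of_real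
        DERIV_tan_half[OF assms(2)])
  from field_vector_diff_chain_at[OF this assms(1)] show ?thesis
    by (simp add: o_def on_path_def[abs_def])
qed

text \<open>Division by i^n removes the expected phase. For \<open>A_ext k n\<close> and 0 \<le> s <
  pi the quotient turns out to be real, so the real part loses nothing.\<close>

definition unrotated_path :: "nat \<Rightarrow> (complex \<Rightarrow> complex) \<Rightarrow> real \<Rightarrow> real" where
  "unrotated_path n f s = Re (on_path f s / \<i> ^ n)"

lemma Re_Im_vector_deriv:
  assumes "(f has_vector_derivative f') (at s)"
  shows "((\<lambda>s. Re (f s)) has_real_derivative Re f') (at s)"
    and "((\<lambda>s. Im (f s)) has_real_derivative Im f') (at s)"
  using bounded_linear.has_vector_derivative[OF bounded_linear_Re assms]
    bounded_linear.has_vector_derivative[OF bounded_linear_Im assms]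
  by (simp_all add: has_real_derivative_iff_has_vector_derivative)

text \<open>For z = i t one has 1 - z^2 = 1 + t^2, which cancels against the derivative of tan(s/2).
  The remaining factor i raises the power of i by one.\<close>

lemma A_tower_path_0:
  assumes f: "f holomorphic_on A_domain" and s: "\<bar>s\<bar> < pi"
  shows "((\<lambda>s. on_path (A_tower f 0) s / \<i> ^ Suc n) has_vector_derivative on_path f s / \<i> ^ n) (at s)"
proof -
  let ?t = "tan (s / 2)"
  have "1 + complex_of_real ?t ^ 2 = of_real (1 + ?t\<^sup>2)" by simp
  then have "1 + complex_of_real ?t ^ 2 \<noteq> 0"
    by (metis add_pos_nonneg less_irrefl of_real_eq_0_iff zero_le_power2 zero_less_one)
  then have "\<i> * of_real ((1 + ?t\<^sup>2) / 2) *
      (2 * f (\<i> * of_real ?t) / (1 - (\<i> * of_real ?t)\<^sup>2)) / \<i> ^ Suc n = on_path f s / \<i> ^ n"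
    by (simp add: on_path_def power_mult_distrib)
  with has_vector_derivative_divide[OF on_path_deriv[OF A_tower_0_deriv[OF f imaginary_in_A_domain], OF s],
      of "\<i> ^ Suc n"]
  show ?thesis by metis
qed

text \<open>The factors i of dz and z cancel: dz/z is the real form ds / sin s, and the power of i
  is unchanged.\<close>

lemma A_tower_path_Suc:
  assumes f: "f holomorphic_on A_domain" and s: "0 < s" "s < pi"
  shows "((\<lambda>s. on_path (A_tower f (Suc j)) s / \<i> ^ n) has_vector_derivative
           on_path (A_tower f j) s / \<i> ^ n / of_real (sin s)) (at s)"
proof -
  let ?t = "tan (s / 2)"
  have t: "?t > 0" using s by (intro tan_gt_zero) auto
  have "sin s > 0" using s by (intro sin_gt_zero)
  then have "(1 + ?t\<^sup>2) / 2 / ?t = 1 / sin s"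
    using sin_eq_tan_half[of s] s t by (simp add: field_simps)
  then have *: "complex_of_real ((1 + ?t\<^sup>2) / 2) / of_real ?t = 1 / of_real (sin s)"
    by (metis of_real_1 of_real_divide)
  have "\<i> * of_real ((1 + ?t\<^sup>2) / 2) * (A_tower f j (\<i> * of_real ?t) / (\<i> * of_real ?t)) / \<i> ^ n =
      (of_real ((1 + ?t\<^sup>2) / 2) / of_real ?t) * A_tower f j (\<i> * of_real ?t) / \<i> ^ n"
    using t by (simp del: A_tower.simps)
  also have "\<dots> = on_path (A_tower f j) s / \<i> ^ n / of_real (sin s)"
    unfolding * by (simp add: on_path_def)
  finally show ?thesis
    using has_vector_derivative_divide[OF on_path_deriv[OF A_tower_Suc_deriv[OF f imaginary_in_A_domain, of ?t j]],
      of "\<i> ^ n"] s t by auto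
qed

lemma on_path_differentiable:
  assumes f: "f holomorphic_on A_domain" and s: "\<bar>s\<bar> < pi"
  obtains D where "((\<lambda>s. on_path f s / \<i> ^ n) has_vector_derivative D) (at s)"
  using has_vector_derivative_divide[OF on_path_deriv[OF holomorphic_derivI[OF f open_A_domain imaginary_in_A_domain] s]]
  by blast

lemma unrotated_path_differentiable:
  assumes f: "f holomorphic_on A_domain" and s: "\<bar>s\<bar> < pi"
  obtains D where "(unrotated_path n f has_real_derivative D) (at s)"
  using on_path_differentiable[OF assms, of n] Re_Im_vector_deriv(1) unfolding unrotated_path_def[abs_def] by metis

lemma Im_path_continuous:
  assumes f: "f holomorphic_on A_domain" and "b < pi"
  shows "continuous_on {0..b} (\<lambda>s. Im (on_path f s / \<i> ^ n))"
proof (rule continuous_at_imp_continuous_on, rule ballI)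
  fix s assume "s \<in> {0..b}"
  with assms have "\<bar>s\<bar> < pi" by auto
  then obtain D where "((\<lambda>s. on_path f s / \<i> ^ n) has_vector_derivative D) (at s)"
    by (rule on_path_differentiable[OF f])
  from Re_Im_vector_deriv(2)[OF this] show "isCont (\<lambda>s. Im (on_path f s / \<i> ^ n)) s"
    by (rule DERIV_isCont)
qed

text \<open>The imaginary part starts at 0 and has derivative 0, because the level below is real;
  this climbs the tower.\<close>

lemma A_tower_path_real:
  assumes f: "f holomorphic_on A_domain"
    and real: "\<And>s. 0 \<le> s \<Longrightarrow> s < pi \<Longrightarrow> Im (on_path f s / \<i> ^ n) = 0"
    and s: "0 \<le> s" "s < pi"
  shows "Im (on_path (A_tower f j) s / \<i> ^ Suc n) = 0"
  using s
proof (induction j arbitrary: s)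
  case (0 s)
  let ?h = "\<lambda>s. Im (on_path (A_tower f 0) s / \<i> ^ Suc n)"
  have at0: "?h 0 = 0"
    using A_tower_at_0[OF f, of 0] by (simp add: on_path_def del: A_tower.simps)
  have "?h s = ?h 0" if "s \<noteq> 0"
  proof (rule DERIV_isconst_end[where f = ?h and a = 0 and b = s])
    show "continuous_on {0..s} ?h"
      using Im_path_continuous[OF holomorphic_on_A_tower[OF f] \<open>s < pi\<close>] .
    fix x assume x: "0 < x" "x < s"
    with 0 Re_Im_vector_deriv(2)[OF A_tower_path_0[OF f, of x n]] real[of x]
    show "(?h has_real_derivative 0) (at x)" by auto
  qed (use 0 that in auto)
  with at0 show ?case by metis
next
  case (Suc j s)
  let ?h = "\<lambda>s. Im (on_path (A_tower f (Suc j)) s / \<i> ^ Suc n)"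
  have at0: "?h 0 = 0"
    using A_tower_at_0[OF f, of "Suc j"] by (simp add: on_path_def del: A_tower.simps)
  have "?h s = ?h 0" if "s \<noteq> 0"
  proof (rule DERIV_isconst_end[where f = ?h and a = 0 and b = s])
    show "continuous_on {0..s} ?h"
      using Im_path_continuous[OF holomorphic_on_A_tower[OF f] \<open>s < pi\<close>] .
    fix x assume x: "0 < x" "x < s"
    then have "x < pi" using Suc.prems by simp
    have "Im (on_path (A_tower f j) x / \<i> ^ Suc n / of_real (sin x)) = 0"
      unfolding Im_divide_of_real using Suc.IH[of x] x \<open>x < pi\<close> by simp
    with Re_Im_vector_deriv(2)[OF A_tower_path_Suc[OF f x(1) \<open>x < pi\<close>, of j "Suc n"]]
    show "(?h has_real_derivative 0) (at x)" by metis
  qed (use Suc.prems that in auto)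
  with at0 show ?case by metis
qed

lemma A_ext_path_real:
  "0 \<le> s \<Longrightarrow> s < pi \<Longrightarrow> Im (on_path (A_ext k n) s / \<i> ^ n) = 0"
proof (induction n arbitrary: s)
  case (Suc n)
  then show ?case
    using A_tower_path_real[OF holomorphic_on_A_ext] by (metis A_ext.simps(2))
qed (simp add: on_path_def)

lemma A_ext_eq_unrotated_path:
  assumes "0 \<le> s" "s < pi"
  shows "A_ext k n (\<i> * complex_of_real (tan (s / 2))) = \<i> ^ n * of_real (unrotated_path n (A_ext k n) s)"
proof -
  have "on_path (A_ext k n) s / \<i> ^ n = of_real (unrotated_path n (A_ext k n) s)"
    using A_ext_path_real[OF assms, of k n] by (simp add: unrotated_path_def complex_eq_iff)
  then show ?thesis by (simp add: on_path_def field_simps)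
qed

section \<open>The logarithmic kernel\<close>

text \<open>G(y)/y converges as y tends to 0, and a factor y outweighs any power of log tan(y/2).
  This kills the boundary terms at 0.\<close>

lemma log_power_times_tendsto_0:
  fixes G :: "real \<Rightarrow> real"
  assumes "(G has_real_derivative D) (at 0)" "G 0 = 0"
  shows "((\<lambda>y. (c - ln (tan (y / 2))) ^ j / fact j * G y) \<longlongrightarrow> 0) (at_right 0)"
proof -
  have "((\<lambda>y. G y / y) \<longlongrightarrow> D) (at_right 0)"
    using assms unfolding has_field_derivative_iff by (simp add: filterlim_at_split)
  moreover have "((\<lambda>y. (c - ln (tan (y / 2))) ^ j / fact j * y) \<longlongrightarrow> 0) (at_right 0)"
    by real_asymp
  ultimately have "((\<lambda>y. ((c - ln (tan (y / 2))) ^ j / fact j * y) * (G y / y)) \<longlongrightarrow> 0 * D) (at_right 0)"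
    by (intro tendsto_mult)
  then have "((\<lambda>y. ((c - ln (tan (y / 2))) ^ j / fact j * y) * (G y / y)) \<longlongrightarrow> 0) (at_right 0)"
    by simp
  then show ?thesis
    by (rule Lim_transform_eventually) (auto simp: eventually_at_filter)
qed

text \<open>
  The antiderivative is the Taylor-like sum
  $\Phi(y)=\sum_{i\le j}\frac{(L(s)-L(y))^i}{i!}\,G_{j-i}(y)$ with $L(y)=\log\tan(y/2)$, $L'=1/\sin$: its
  derivative telescopes to the integrand, and $\Phi(s)=G_j(s)$.
\<close>
lemma log_tan_kernel_integral:
  fixes G :: "nat \<Rightarrow> real \<Rightarrow> real"
  assumes s: "0 < s" "s < pi"
    and G0: "\<And>y. 0 < y \<Longrightarrow> y < pi \<Longrightarrow> (G 0 has_real_derivative g y) (at y)"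
    and GS: "\<And>i y. 0 < y \<Longrightarrow> y < pi \<Longrightarrow> (G (Suc i) has_real_derivative G i y / sin y) (at y)"
    and at0: "\<And>i. G i 0 = 0" "\<And>i. \<exists>D. (G i has_real_derivative D) (at 0)"
    and g: "\<And>y. 0 < y \<Longrightarrow> y < pi \<Longrightarrow> g y \<ge> 0" "\<And>y. 0 < y \<Longrightarrow> y < pi \<Longrightarrow> isCont g y"
  shows "(\<integral>\<^sup>+y. indicator {0<..<s} y *
            ennreal ((ln (tan (s / 2)) - ln (tan (y / 2))) ^ j / fact j * g y) \<partial>lborel) = ennreal (G j s)"
    and "G j s \<ge> 0"
proof -
  define L :: "real \<Rightarrow> real" where "L = (\<lambda>y. ln (tan (y / 2)))"
  have L: "(L has_real_derivative 1 / sin y) (at y)" if "0 < y" "y < pi" for y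
    unfolding L_def using DERIV_ln_tan_half that by blast
  have L_mono: "L y \<le> L s" if "0 < y" "y < s" for y
    unfolding L_def using that s by (simp add: tan_gt_zero tan_monotone less_imp_le)
  define h where "h = (\<lambda>y. (L s - L y) ^ j / fact j * g y)"
  define \<Phi> where "\<Phi> = (\<lambda>y. \<Sum>i\<le>j. (L s - L y) ^ i / fact i * G (j - i) y)"
  have h_nonneg: "h y \<ge> 0" if "0 < y" "y < s" for y
    using g(1)[of y] L_mono[OF that] that s by (simp add: h_def)
  have \<Phi>_deriv: "(\<Phi> has_real_derivative h y) (at y)" if y: "0 < y" "y < s" for y
  proof -
    have y': "y < pi" using y s by simp
    \<comment> \<open>In the product rule, differentiating the logarithmic power gives
      \<open>- a i\<close> and differentiating G gives \<open>b i\<close>. The latter is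
      \<open>a (Suc i)\<close>, except for i = j, where the integrand survives.\<close>
    define a where "a = (\<lambda>i. if i = 0 then 0 else (L s - L y) ^ (i - 1) / fact (i - 1) * (G (j - i) y / sin y))"
    define b where "b = (\<lambda>i. if i = j then h y else a (Suc i))"
    have "((\<lambda>y. (L s - L y) ^ i / fact i * G (j - i) y) has_real_derivative b i - a i) (at y)"
      if "i \<le> j" for i
    proof -
      have 1: "((\<lambda>y. (L s - L y) ^ i / fact i) has_real_derivative
          - (if i = 0 then 0 else (L s - L y) ^ (i - 1) / fact (i - 1) / sin y)) (at y)"
        by (cases i)
             (auto intro!: DERIV_cong[OF DERIV_cdivide[OF DERIV_power[OF DERIV_diff[OF DERIV_const L]]]] y y'
                   simp del: of_nat_Suc power_Suc)
      have 2: "(G (j - i) has_real_derivative (if i = j then g y else G (j - Suc i) y / sin y)) (at y)"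
        using G0[OF y(1) y'] GS[OF y(1) y', of "j - Suc i"] that by (auto simp: Suc_diff_Suc)
      show ?thesis
        by (rule DERIV_cong[OF DERIV_mult[OF 1 2]]) (auto simp: a_def b_def h_def algebra_simps)
    qed
    then have "(\<Phi> has_real_derivative (\<Sum>i\<le>j. b i - a i)) (at y)"
      unfolding \<Phi>_def by (intro DERIV_sum) auto
    also have "(\<Sum>i\<le>j. b i - a i) = h y"
    proof -
      have "(\<Sum>i\<le>j. b i) = (\<Sum>i<j. a (Suc i)) + h y"
        unfolding lessThan_Suc_atMost[symmetric] by (simp add: b_def)
      moreover have "(\<Sum>i\<le>j. a i) = a 0 + (\<Sum>i<j. a (Suc i))"
        by (simp add: sum.atMost_shift)
      ultimately show ?thesis
        by (simp add: sum_subtractf a_def)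
    qed
    finally show ?thesis .
  qed
  have "(\<Phi> \<longlongrightarrow> (\<Sum>i\<le>j. 0)) (at_right 0)"
    unfolding \<Phi>_def L_def using at0 log_power_times_tendsto_0 by (intro tendsto_sum) blast
  then have lim0: "(\<Phi> \<longlongrightarrow> 0) (at_right 0)" by simp
  have "isCont (\<lambda>y. (L s - L y) ^ i / fact i * G (j - i) y) s" for i
    using DERIV_isCont[OF L[OF s]] DERIV_isCont[OF G0[OF s]] DERIV_isCont[OF GS[OF s]]
    by (intro continuous_intros) (auto, cases "j - i", auto)
  then have "isCont \<Phi> s"
    unfolding \<Phi>_def by (rule continuous_sum)
  then have lims: "(\<Phi> \<longlongrightarrow> \<Phi> s) (at_left s)"
    by (simp add: continuous_at_imp_continuous_at_within continuous_within[symmetric])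
  have "\<Phi> s = (\<Sum>i\<in>{0}. (L s - L s) ^ i / fact i * G (j - i) s)"
    unfolding \<Phi>_def by (rule sum.mono_neutral_right) auto
  then have \<Phi>s: "\<Phi> s = G j s" by simp
  have h_cont: "isCont h y" if "0 < y" "y < s" for y
    unfolding h_def using DERIV_isCont[OF L, of y] g(2)[of y] that s by (intro continuous_intros) auto
  have at: "at_right (0 :: ereal) = filtermap ereal (at_right 0)"
    unfolding zero_ereal_def by (rule at_right_ereal)
  \<comment> \<open>The logarithm is unbounded at 0, so only one-sided limits of the antiderivative
    are used; as the integrand is nonnegative, they give integrability along with the value.\<close>
  have FTC: "set_integrable lborel (einterval 0 (ereal s)) h" "(LBINT x=0..ereal s. h x) = G j s - 0"
    using s \<Phi>_deriv h_cont h_nonneg lim0 lims[unfolded \<Phi>s]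
    by (intro interval_integral_FTC_nonneg[of 0 "ereal s" \<Phi> h 0 "G j s"]; auto simp: at at_left_ereal filterlim_filtermap o_def)+
  have e: "einterval 0 (ereal s) = {0<..<s}"
    by (auto simp: einterval_def)
  have int: "integrable lborel (\<lambda>x. indicator {0<..<s} x *\<^sub>R h x)"
      "integral\<^sup>L lborel (\<lambda>x. indicator {0<..<s} x *\<^sub>R h x) = G j s"
    using FTC s unfolding interval_lebesgue_integral_def e set_integrable_def set_lebesgue_integral_def
    by auto
  show G_nonneg: "G j s \<ge> 0"
    unfolding int(2)[symmetric] using h_nonneg by (intro Bochner_Integration.integral_nonneg) (auto simp: indicator_def)
  have "(\<integral>\<^sup>+y. ennreal (indicator {0<..<s} y *\<^sub>R h y) \<partial>lborel) = ennreal (G j s)"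
    using int h_nonneg by (subst nn_integral_eq_integral) (auto simp: indicator_def)
  also have "(\<lambda>y. ennreal (indicator {0<..<s} y *\<^sub>R h y)) = (\<lambda>y. indicator {0<..<s} y * ennreal (h y))"
    by (auto simp: indicator_def)
  finally show "(\<integral>\<^sup>+y. indicator {0<..<s} y *
      ennreal ((ln (tan (s / 2)) - ln (tan (y / 2))) ^ j / fact j * g y) \<partial>lborel) = ennreal (G j s)"
    unfolding h_def L_def .
qed

lemma isCont_unrotated_path:
  assumes "f holomorphic_on A_domain" and "\<bar>s\<bar> < pi"
  shows "isCont (unrotated_path n f) s"
  using unrotated_path_differentiable[OF assms] DERIV_isCont by metis

text \<open>One integral replaces all levels belonging to one entry of the index. The nonnegativity
  obtained is the hypothesis required for the next entry.\<close>

lemma unrotated_path_A_tower: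
  assumes f: "f holomorphic_on A_domain"
    and g: "\<And>y. 0 < y \<Longrightarrow> y < pi \<Longrightarrow> unrotated_path n f y \<ge> 0" and s: "0 < s" "s < pi"
  shows "(\<integral>\<^sup>+y. indicator {0<..<s} y *
            ennreal ((ln (tan (s / 2)) - ln (tan (y / 2))) ^ j / fact j * unrotated_path n f y) \<partial>lborel) =
          ennreal (unrotated_path (Suc n) (A_tower f j) s)"
    and "unrotated_path (Suc n) (A_tower f j) s \<ge> 0"
proof -
  note h = holomorphic_on_A_tower[OF f]
  have 0: "(unrotated_path (Suc n) (A_tower f 0) has_real_derivative unrotated_path n f y) (at y)" if "0 < y" "y < pi" for y
    using Re_Im_vector_deriv(1)[OF A_tower_path_0[OF f, of y n]] that
    by (simp add: unrotated_path_def[abs_def] del: A_tower.simps)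
  have Suc: "(unrotated_path (Suc n) (A_tower f (Suc i)) has_real_derivative unrotated_path (Suc n) (A_tower f i) y / sin y) (at y)"
    if "0 < y" "y < pi" for y i
    using Re_Im_vector_deriv(1)[OF A_tower_path_Suc[OF f that, of i "Suc n"]]
    unfolding unrotated_path_def[abs_def] Re_divide_of_real .
  have at0: "unrotated_path (Suc n) (A_tower f i) 0 = 0" for i
    using A_tower_at_0[OF f, of i] by (simp add: unrotated_path_def on_path_def del: A_tower.simps)
  have at0': "\<exists>D. (unrotated_path (Suc n) (A_tower f i) has_real_derivative D) (at 0)" for i
    using unrotated_path_differentiable[OF h, of 0 "Suc n" i] by auto
  have cont: "isCont (unrotated_path n f) y" if "0 < y" "y < pi" for y
    using isCont_unrotated_path[OF f] that by simp
  note * = log_tan_kernel_integral[where G = "\<lambda>i. unrotated_path (Suc n) (A_tower f i)" and g = "unrotated_path n f" and j = j,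
    OF s 0 Suc at0 at0' g cont]
  from *(1) show "(\<integral>\<^sup>+y. indicator {0<..<s} y *
            ennreal ((ln (tan (s / 2)) - ln (tan (y / 2))) ^ j / fact j * unrotated_path n f y) \<partial>lborel) =
          ennreal (unrotated_path (Suc n) (A_tower f j) s)" .
  from *(2) show "unrotated_path (Suc n) (A_tower f j) s \<ge> 0" .
qed

lemma unrotated_path_A_ext_nonneg: "0 < s \<Longrightarrow> s < pi \<Longrightarrow> unrotated_path n (A_ext k n) s \<ge> 0"
proof (induction n arbitrary: s)
  case (Suc n)
  then show ?case
    unfolding A_ext.simps by (intro unrotated_path_A_tower(2)[OF holomorphic_on_A_ext])
qed (simp add: unrotated_path_def on_path_def)

subsection \<open>The integral over the simplex\<close>

text \<open>
  For \<open>n = 0\<close> the first condition reads \<open>0 < \<sigma>\<close>, so that the induction below can start at \<open>n = 0\<close>;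
  \<open>angle_simplex\<close> would refer to the junk value \<open>\<theta> 1\<close> there.
\<close>
definition angle_simplex' :: "nat \<Rightarrow> real \<Rightarrow> (nat \<Rightarrow> real) set" where
  "angle_simplex' n \<sigma> = {\<theta> \<in> {1..n} \<rightarrow>\<^sub>E UNIV.
     0 < (\<theta>(Suc n := \<sigma>)) 1 \<and> (\<forall>u\<in>{1..n}. (\<theta>(Suc n := \<sigma>)) u < (\<theta>(Suc n := \<sigma>)) (Suc u))}"

lemma angle_simplex'_eq: "n \<ge> 1 \<Longrightarrow> angle_simplex' n \<sigma> = angle_simplex n \<sigma>"
  by (auto simp: angle_simplex'_def angle_simplex_def)

text \<open>For \<sigma> < pi this keeps all angles in (0, pi), where log tan(\<theta>/2) is well
  behaved and increasing.\<close>

lemma angle_simplex'_bounds: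
  assumes "\<theta> \<in> angle_simplex' n \<sigma>" and "u \<in> {1..Suc n}"
  shows "0 < (\<theta>(Suc n := \<sigma>)) u" and "(\<theta>(Suc n := \<sigma>)) u \<le> \<sigma>"
proof -
  let ?\<theta> = "\<theta>(Suc n := \<sigma>)"
  have incr: "?\<theta> v < ?\<theta> (Suc v)" if "v \<in> {1..n}" for v
    using assms(1) that unfolding angle_simplex'_def by blast
  have "1 \<le> u" "u \<le> Suc n" using assms(2) by auto
  from this show "0 < ?\<theta> u"
  proof (induction u rule: dec_induct)
    case base
    then show ?case using assms(1) by (simp add: angle_simplex'_def)
  next
    case (step v)
    with incr[of v] show ?case
      by (meson Suc_leD atLeastAtMost_iff not_less_eq_eq order_less_trans)
  qed
  from \<open>u \<le> Suc n\<close> \<open>1 \<le> u\<close> show "?\<theta> u \<le> \<sigma>"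
  proof (induction u rule: inc_induct)
    case (step v)
    then have "v \<in> {1..n}" by simp
    with incr[of v] step show ?case
      by (meson le_SucI less_imp_le order_trans)
  qed simp
qed

lemma angle_simplex'_pos: "\<theta> \<in> angle_simplex' n \<sigma> \<Longrightarrow> 0 < \<sigma>"
  using angle_simplex'_bounds(1)[of \<theta> n \<sigma> "Suc n"] by simp

text \<open>Slicing at the last coordinate: y becomes the upper endpoint for the remaining
  angles.\<close>

lemma angle_simplex'_Suc:
  assumes "x \<in> {1..n} \<rightarrow>\<^sub>E UNIV"
  shows "x(Suc n := y) \<in> angle_simplex' (Suc n) \<sigma> \<longleftrightarrow> y < \<sigma> \<and> x \<in> angle_simplex' n y"
proof -
  let ?\<theta> = "(x(Suc n := y))(Suc (Suc n) := \<sigma>)"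
  have "x(Suc n := y) \<in> {1..Suc n} \<rightarrow>\<^sub>E UNIV"
    using assms by (auto simp: PiE_def extensional_def)
  moreover have "(\<forall>u\<in>{1..Suc n}. ?\<theta> u < ?\<theta> (Suc u)) \<longleftrightarrow>
      y < \<sigma> \<and> (\<forall>u\<in>{1..n}. (x(Suc n := y)) u < (x(Suc n := y)) (Suc u))"
    by (simp add: atLeastAtMostSuc_conv)
  ultimately show ?thesis
    using assms unfolding angle_simplex'_def by (simp cong: conj_cong) blast
qed

lemma log_tan_integrand_Suc:
  "log_tan_integrand (Suc n) k \<sigma> (x(Suc n := y)) =
     (ln (tan (\<sigma> / 2)) - ln (tan (y / 2))) ^ (k (Suc n) - 1) / fact (k (Suc n) - 1) *
     log_tan_integrand n k y x"
proof -
  have "(\<Prod>u=1..n. (ln (tan ((x(Suc n := y, Suc (Suc n) := \<sigma>)) (Suc u) / 2)) -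
            ln (tan ((x(Suc n := y, Suc (Suc n) := \<sigma>)) u / 2))) ^ (k u - 1) / fact (k u - 1)) =
        log_tan_integrand n k y x"
    unfolding log_tan_integrand_def by (intro prod.cong) auto
  then show ?thesis
    by (simp add: log_tan_integrand_def)
qed

lemma log_tan_integrand_nonneg:
  assumes "\<theta> \<in> angle_simplex' n \<sigma>" and "\<sigma> < pi"
  shows "log_tan_integrand n k \<sigma> \<theta> \<ge> 0"
  unfolding log_tan_integrand_def
proof (intro prod_nonneg ballI divide_nonneg_nonneg zero_le_power)
  fix u assume u: "u \<in> {1..n}"
  let ?\<theta> = "\<theta>(Suc n := \<sigma>)"
  have "0 < ?\<theta> u"
    by (rule angle_simplex'_bounds(1)[OF assms(1)]) (use u in auto)
  moreover have "?\<theta> u < ?\<theta> (Suc u)"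
    using assms(1) u unfolding angle_simplex'_def by blast
  moreover have "?\<theta> (Suc u) \<le> \<sigma>"
    by (rule angle_simplex'_bounds(2)[OF assms(1)]) (use u in auto)
  ultimately have "0 < tan (?\<theta> u / 2)" "tan (?\<theta> u / 2) < tan (?\<theta> (Suc u) / 2)"
    using assms(2) by (intro tan_gt_zero tan_monotone; linarith)+
  then show "0 \<le> ln (tan (?\<theta> (Suc u) / 2)) - ln (tan (?\<theta> u / 2))"
    by simp
qed simp

lemma fun_upd_component_measurable:
  "u \<in> {1..Suc n} \<Longrightarrow> (\<lambda>\<theta>. (\<theta>(Suc n := \<sigma>)) u) \<in> borel_measurable (Pi\<^sub>M {1..n} (\<lambda>_. lborel :: real measure))"
  by (cases "u = Suc n") (auto intro!: measurable_component_singleton)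

lemma angle_simplex'_measurable:
  "angle_simplex' n \<sigma> \<in> sets (Pi\<^sub>M {1..n} (\<lambda>_. lborel))"
proof -
  let ?M = "Pi\<^sub>M {1..n} (\<lambda>_. lborel :: real measure)"
  have 1: "{\<theta> \<in> space ?M. 0 < (\<theta>(Suc n := \<sigma>)) 1} \<in> sets ?M"
    by (intro borel_measurable_less borel_measurable_const fun_upd_component_measurable) simp
  have "{\<theta> \<in> space ?M. (\<theta>(Suc n := \<sigma>)) u < (\<theta>(Suc n := \<sigma>)) (Suc u)} \<in> sets ?M" if "u \<in> {1..n}" for u
    using that by (intro borel_measurable_less fun_upd_component_measurable) auto
  then have 2: "{\<theta> \<in> space ?M. \<forall>u\<in>{1..n}. (\<theta>(Suc n := \<sigma>)) u < (\<theta>(Suc n := \<sigma>)) (Suc u)} \<in> sets ?M"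
    by (rule sets.sets_Collect_finite_All) simp_all
  have "{\<theta> \<in> space (Pi\<^sub>M {1..n} (\<lambda>_. lborel)). 0 < (\<theta>(Suc n := \<sigma>)) 1 \<and>
          (\<forall>u\<in>{1..n}. (\<theta>(Suc n := \<sigma>)) u < (\<theta>(Suc n := \<sigma>)) (Suc u))} \<in> sets (Pi\<^sub>M {1..n} (\<lambda>_. lborel))"
    by (rule sets.sets_Collect_conj[OF 2 1])
  then show ?thesis
    unfolding angle_simplex'_def space_PiM space_lborel space_borel .
qed

lemma log_tan_integrand_measurable:
  "log_tan_integrand n k \<sigma> \<in> borel_measurable (Pi\<^sub>M {1..n} (\<lambda>_. lborel))"
proof -
  have "(\<lambda>x :: real. ln (tan (x / 2))) \<in> borel_measurable borel"
    unfolding tan_def by measurable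
  from measurable_compose[OF fun_upd_component_measurable this]
  have m: "(\<lambda>\<theta>. ln (tan ((\<theta>(Suc n := \<sigma>)) u / 2))) \<in> borel_measurable (Pi\<^sub>M {1..n} (\<lambda>_. lborel))"
    if "u \<in> {1..Suc n}" for u
    using that by blast
  then show ?thesis
    unfolding log_tan_integrand_def[abs_def]
    by (intro borel_measurable_prod borel_measurable_divide borel_measurable_power
        borel_measurable_diff borel_measurable_const m) simp_all
qed

interpretation lborel_product: product_sigma_finite "\<lambda>_ :: nat. lborel :: real measure"
  by standard

text \<open>Tonelli with the last angle y outermost: the inner simplex ends at y, so the induction
  hypothesis is needed for every endpoint, and the kernel formula does the outer integral.
  Nonnegative integrals allow this before integrability is known.\<close>

lemma nn_integral_log_tan:
  assumes "\<sigma> < pi"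
  shows "(\<integral>\<^sup>+\<theta>. indicator (angle_simplex' n \<sigma>) \<theta> * ennreal (log_tan_integrand n k \<sigma> \<theta>)
            \<partial>Pi\<^sub>M {1..n} (\<lambda>_. lborel)) =
         (if \<sigma> > 0 then ennreal (unrotated_path n (A_ext k n) \<sigma>) else 0)"
proof (cases "\<sigma> > 0")
  case False
  then have "angle_simplex' n \<sigma> = {}"
    using angle_simplex'_pos by blast
  with False show ?thesis by simp
next
  case True
  from this assms show ?thesis
  proof (induction n arbitrary: \<sigma>)
    case 0
    then have "indicator (angle_simplex' 0 \<sigma>) (\<lambda>_. undefined) = (1 :: ennreal)"
      by (simp add: angle_simplex'_def)
    with 0 show ?case
      by (simp add: log_tan_integrand_def unrotated_path_def on_path_def lborel_product.nn_integral_empty)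
  next
    case (Suc n)
    let ?w = "\<lambda>y. (ln (tan (\<sigma> / 2)) - ln (tan (y / 2))) ^ (k (Suc n) - 1) / fact (k (Suc n) - 1)"
    let ?M = "\<lambda>n. Pi\<^sub>M {1..n} (\<lambda>_ :: nat. lborel :: real measure)"
    let ?F = "\<lambda>n \<sigma> \<theta>. indicator (angle_simplex' n \<sigma>) \<theta> * ennreal (log_tan_integrand n k \<sigma> \<theta>)"
    have meas: "?F n \<sigma> \<in> borel_measurable (?M n)" for n \<sigma>
      using angle_simplex'_measurable log_tan_integrand_measurable
      by (intro borel_measurable_times_ennreal borel_measurable_indicator) auto
    have ins: "{1..Suc n} = insert (Suc n) {1..n}" by auto
    have inner: "(\<integral>\<^sup>+x. ?F (Suc n) \<sigma> (x(Suc n := y)) \<partial>?M n) =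
        indicator {0<..<\<sigma>} y * ennreal (?w y * unrotated_path n (A_ext k n) y)" for y
    proof (cases "y \<in> {0<..<\<sigma>}")
      case True
      with Suc.prems have "tan (y / 2) \<le> tan (\<sigma> / 2)" "0 < tan (y / 2)"
        by (auto simp: tan_monotone tan_gt_zero less_imp_le)
      then have w: "?w y \<ge> 0" by simp
      have "(\<integral>\<^sup>+x. ?F (Suc n) \<sigma> (x(Suc n := y)) \<partial>?M n) = (\<integral>\<^sup>+x. ennreal (?w y) * ?F n y x \<partial>?M n)"
      proof (rule nn_integral_cong)
        fix x assume "x \<in> space (?M n)"
        then have "x \<in> {1..n} \<rightarrow>\<^sub>E UNIV" by (simp add: space_PiM)
        from angle_simplex'_Suc[OF this, of y \<sigma>] True
        have "indicator (angle_simplex' (Suc n) \<sigma>) (x(Suc n := y)) =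
            (indicator (angle_simplex' n y) x :: ennreal)"
          by (simp add: indicator_def)
        moreover have "ennreal (log_tan_integrand (Suc n) k \<sigma> (x(Suc n := y))) =
            ennreal (?w y) * ennreal (log_tan_integrand n k y x)"
          unfolding log_tan_integrand_Suc by (rule ennreal_mult'[OF w])
        ultimately show "?F (Suc n) \<sigma> (x(Suc n := y)) = ennreal (?w y) * ?F n y x"
          by (simp only: mult.left_commute)
      qed
      also have "\<dots> = ennreal (?w y) * ennreal (unrotated_path n (A_ext k n) y)"
        unfolding nn_integral_cmult[OF meas] using Suc.IH[of y] True Suc.prems by simp
      also have "\<dots> = ennreal (?w y * unrotated_path n (A_ext k n) y)"
        by (rule ennreal_mult'[OF w, symmetric])
      finally show ?thesis
        using True by simp
    next
      case False
      \<comment> \<open>For y \<ge> \<sigma> the last inequality fails; for y \<le> 0 the inner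
        simplex is empty.\<close>
      have "(\<integral>\<^sup>+x. ?F (Suc n) \<sigma> (x(Suc n := y)) \<partial>?M n) = (\<integral>\<^sup>+x. 0 \<partial>?M n)"
      proof (rule nn_integral_cong)
        fix x assume "x \<in> space (?M n)"
        then have "x \<in> {1..n} \<rightarrow>\<^sub>E UNIV" by (simp add: space_PiM)
        from angle_simplex'_Suc[OF this, of y \<sigma>] False angle_simplex'_pos[of x n y]
        have "x(Suc n := y) \<notin> angle_simplex' (Suc n) \<sigma>" by auto
        then show "?F (Suc n) \<sigma> (x(Suc n := y)) = 0" by simp
      qed
      with False show ?thesis by simp
    qed
    have "(\<integral>\<^sup>+\<theta>. ?F (Suc n) \<sigma> \<theta> \<partial>?M (Suc n)) =
        (\<integral>\<^sup>+y. \<integral>\<^sup>+x. ?F (Suc n) \<sigma> (x(Suc n := y)) \<partial>?M n \<partial>lborel)"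
      unfolding ins by (rule lborel_product.product_nn_integral_insert_rev)
         (use meas[of "Suc n" \<sigma>] ins in auto)
    also have "\<dots> = ennreal (unrotated_path (Suc n) (A_ext k (Suc n)) \<sigma>)"
      unfolding inner A_ext.simps using Suc.prems
      by (intro unrotated_path_A_tower(1)[OF holomorphic_on_A_ext] unrotated_path_A_ext_nonneg)
    finally show ?case
      using Suc.prems by simp
  qed
qed

lemma log_tan_set_integral:
  assumes n: "n \<ge> 1" and \<sigma>: "0 \<le> \<sigma>" "\<sigma> < pi"
  shows "set_integrable (Pi\<^sub>M {1..n} (\<lambda>_. lborel)) (angle_simplex n \<sigma>) (log_tan_integrand n k \<sigma>)"
    and "A_ext k n (\<i> * complex_of_real (tan (\<sigma> / 2))) =
      \<i> ^ n * complex_of_real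
        (LINT \<theta>:angle_simplex n \<sigma>|Pi\<^sub>M {1..n} (\<lambda>_. lborel). log_tan_integrand n k \<sigma> \<theta>)"
proof -
  let ?M = "Pi\<^sub>M {1..n} (\<lambda>_. lborel :: real measure)"
  let ?f = "\<lambda>\<theta>. indicator (angle_simplex n \<sigma>) \<theta> *\<^sub>R log_tan_integrand n k \<sigma> \<theta>"
  define T where "T = unrotated_path n (A_ext k n) \<sigma>"
  have A: "A_ext k n (\<i> * complex_of_real (tan (\<sigma> / 2))) = \<i> ^ n * complex_of_real T"
    unfolding T_def by (rule A_ext_eq_unrotated_path[OF \<sigma>])
  obtain n' where "n = Suc n'" using n by (cases n) auto
  then have "A_ext k n 0 = 0"
    using A_tower_at_0[OF holomorphic_on_A_ext] by simp
  \<comment> \<open>At \<sigma> = 0 the simplex is empty; the other side matches because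
    \<open>A_ext k n\<close> vanishes at the origin for n \<ge> 1.\<close>
  then have T0: "T = 0" if "\<sigma> = 0"
    using that by (simp add: T_def unrotated_path_def on_path_def)
  have T: "T \<ge> 0"
  proof (cases "\<sigma> = 0")
    case False
    with \<sigma> show ?thesis unfolding T_def by (intro unrotated_path_A_ext_nonneg) auto
  qed (simp add: T0)
  have meas: "?f \<in> borel_measurable ?M"
    using angle_simplex'_measurable[of n \<sigma>] angle_simplex'_eq[OF n, of \<sigma>]
    by (intro borel_measurable_scaleR borel_measurable_indicator log_tan_integrand_measurable) simp
  have nonneg: "?f \<theta> \<ge> 0" for \<theta>
    using log_tan_integrand_nonneg[of \<theta> n \<sigma> k] \<sigma> angle_simplex'_eq[OF n, of \<sigma>]
    by (simp add: indicator_def)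
  have "(\<integral>\<^sup>+\<theta>. ennreal (?f \<theta>) \<partial>?M) =
      (\<integral>\<^sup>+\<theta>. indicator (angle_simplex' n \<sigma>) \<theta> * ennreal (log_tan_integrand n k \<sigma> \<theta>) \<partial>?M)"
    by (intro nn_integral_cong) (simp add: indicator_def angle_simplex'_eq[OF n])
  also have "\<dots> = ennreal T"
    unfolding nn_integral_log_tan[OF \<sigma>(2)] T_def[symmetric] using \<sigma> T0 by auto
  finally have "integrable ?M ?f \<and> integral\<^sup>L ?M ?f = T"
    using nn_integral_eq_integrable[OF meas AE_I2[OF nonneg] T] by blast
  with A show "set_integrable ?M (angle_simplex n \<sigma>) (log_tan_integrand n k \<sigma>)"
    and "A_ext k n (\<i> * complex_of_real (tan (\<sigma> / 2))) =
      \<i> ^ n * complex_of_real (LINT \<theta>:angle_simplex n \<sigma>|?M. log_tan_integrand n k \<sigma> \<theta>)"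
    unfolding set_integrable_def set_lebesgue_integral_def by auto
qed

theorem theorem3:
  fixes n :: nat and k :: "nat \<Rightarrow> nat"
  assumes "n \<ge> 1" and "\<And>u. u \<in> {1..n} \<Longrightarrow> k u \<ge> 1"
  shows "(\<forall>\<sigma>\<in>{0..<pi}.
      set_integrable (Pi\<^sub>M {1..n} (\<lambda>_. lborel)) (angle_simplex n \<sigma>) (log_tan_integrand n k \<sigma>) \<and>
      multiple_A n k (\<i> * complex_of_real (tan (\<sigma> / 2))) =
        \<i> ^ n * complex_of_real
          (LINT \<theta>:angle_simplex n \<sigma>|Pi\<^sub>M {1..n} (\<lambda>_. lborel). log_tan_integrand n k \<sigma> \<theta>)) \<and>
    multiple_A n k \<i> =
      \<i> ^ n * complex_of_real
        (LINT \<theta>:angle_simplex n (pi / 2)|Pi\<^sub>M {1..n} (\<lambda>_. lborel).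
          log_tan_integrand n k (pi / 2) \<theta>)"
proof -
  have eq: "multiple_A n k (\<i> * complex_of_real (tan (\<sigma> / 2))) =
        \<i> ^ n * complex_of_real
          (LINT \<theta>:angle_simplex n \<sigma>|Pi\<^sub>M {1..n} (\<lambda>_. lborel). log_tan_integrand n k \<sigma> \<theta>)"
    if "0 \<le> \<sigma>" "\<sigma> < pi" for \<sigma>
    using multiple_A_eq_A_ext[of n k, OF assms imaginary_in_A_domain]
      log_tan_set_integral(2)[OF assms(1) that] by simp
  \<comment> \<open>The point i is on the boundary of the unit disc but inside
    \<open>A_domain\<close>, so the special value is just \<sigma> = pi/2, with no limit to
    take.\<close>
  have "tan (pi / 2 / 2) = 1"
    using tan_45 by simp
  with eq[of "pi / 2"] eq log_tan_set_integral(1)[OF assms(1)] show ?thesis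
    by simp
qed

end
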